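(* Let $P\subset\mathbb{Z}_+^n$ be a discrete polymatroid on $[n]$, and let $u=(a_1,\dots,a_n)$ and $v=(b_1,\dots,b_n)$ be bases of $P$. Then for each $i\in[n]$ with $a_i>b_i$ there is $j\in[n]$ with $a_j<b_j$ such that both $u-\varepsilon_i+\varepsilon_j$ and $v-\varepsilon_j+\varepsilon_i$ are bases of $P$.
   Context: $[n]=\{1,\dots,n\}$; $\mathbb{Z}_+^n$ is the set of integer vectors with nonnegative entries; $\varepsilon_1,\dots,\varepsilon_n$ are the canonical basis vectors of $\mathbb{R}^n$. For $u\in\mathbb{Z}_+^n$, $|u|=\sum_i u(i)$. $u\le v$ means $u(i)\le v(i)$ for all $i$; $u<v$ means $u\le v$ and $u\neq v$; $u\vee v$ is the componentwise maximum. A discrete polymatroid on $[n]$ is a nonempty finite set $P\subset\mathbb{Z}_+^n$ such that (D1) if $u\in P$, $v\in\mathbb{Z}_+^n$ and $v\le u$, then $v\in P$; (D2) if $u,v\in P$ with $|v|>|u|$, then there is $w\in P$ with $u<w\le u\vee v$. A base of $P$ is a vector $u\in P$ such that $u<v$ for no $v\in P$. *)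

theory Defs
  imports "HOL-Analysis.Finite_Cartesian_Product"
begin

text \<open>The ground set \<open>[n]\<close> is the finite index type \<open>'n\<close>, and integer vectors are elements of
  \<open>int ^ 'n\<close>, whose library order is componentwise: \<open>u < v\<close> holds iff \<open>u \<le> v\<close> and \<open>u \<noteq> v\<close>.
  The canonical basis vector at \<open>i\<close> is \<open>axis i 1\<close>.\<close>

definition nonneg_vectors :: "(int ^ 'n::finite) set" where
  "nonneg_vectors = {u. \<forall>i. 0 \<le> u $ i}"

definition modulus :: "int ^ 'n::finite \<Rightarrow> int" where
  "modulus u = (\<Sum>i\<in>UNIV. u $ i)"

text \<open>The library supplies \<open>sup\<close> on vectors only over ordered Euclidean spaces, hence not over
  the integers.\<close>

definition vec_join :: "int ^ 'n::finite \<Rightarrow> int ^ 'n \<Rightarrow> int ^ 'n" where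
  "vec_join u v = (\<chi> i. max (u $ i) (v $ i))"

definition discrete_polymatroid :: "(int ^ 'n::finite) set \<Rightarrow> bool" where
  "discrete_polymatroid P \<longleftrightarrow>
     P \<noteq> {} \<and> finite P \<and> P \<subseteq> nonneg_vectors \<and>
     (\<forall>u\<in>P. \<forall>v\<in>nonneg_vectors. v \<le> u \<longrightarrow> v \<in> P) \<and>
     (\<forall>u\<in>P. \<forall>v\<in>P. modulus v > modulus u \<longrightarrow> (\<exists>w\<in>P. u < w \<and> w \<le> vec_join u v))"

definition polymatroid_base :: "(int ^ 'n::finite) set \<Rightarrow> int ^ 'n \<Rightarrow> bool" where
  "polymatroid_base P u \<longleftrightarrow> u \<in> P \<and> \<not> (\<exists>v\<in>P. u < v)"

end

theory Submission
  imports Defs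
begin

text \<open>The proof carries the symmetric exchange argument for matroids over to polymatroids. For
  matroid bases \<open>u\<close> and \<open>v\<close> and an element \<open>i\<close> of \<open>u\<close> outside \<open>v\<close>, the fundamental circuit \<open>C\<close> of
  \<open>i\<close> in \<open>v + i\<close> has an element other than \<open>i\<close> outside the span of \<open>u - i\<close>: otherwise \<open>C - i\<close>, and
  hence \<open>i\<close>, would lie in that span. Such an element can be exchanged for \<open>i\<close> in both bases.

  In a polymatroid the support of the circuit becomes the set \<open>T\<close> of all \<open>j\<close> such that
  \<open>v + \<epsilon>\<^sub>i - \<epsilon>\<^sub>j\<close> lies in \<open>P\<close>, and \<open>C - i\<close> becomes the vector \<open>v\<^sub>T\<close> that equals \<open>v\<close> on \<open>T\<close> and \<open>0\<close>
  elsewhere. The vector \<open>v\<^sub>T + \<epsilon>\<^sub>i\<close> is not in \<open>P\<close>: it would extend below \<open>v + \<epsilon>\<^sub>i\<close> to an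
  element of \<open>P\<close> of modulus \<open>|v|\<close>, that is, to some \<open>v + \<epsilon>\<^sub>i - \<epsilon>\<^sub>j\<close> with \<open>j\<close> in \<open>T\<close>; but at every
  coordinate of \<open>T\<close> it already agrees with \<open>v + \<epsilon>\<^sub>i\<close>
  (\<open>ex_exchange_below_base_plus_unit\<close>). Now extend \<open>v\<^sub>T\<close> below \<open>v\<^sub>T \<or> u\<close> to some \<open>w\<close> of modulus at
  least \<open>|u|\<close> (\<open>ex_augmentation_below_join\<close>). As \<open>v\<^sub>T + \<epsilon>\<^sub>i\<close> is not in \<open>P\<close>, the coordinate of \<open>w\<close> at \<open>i\<close>
  is still that of \<open>v\<close>, so that \<open>w\<close> does not exceed \<open>u - \<epsilon>\<^sub>i\<close> there. On the other hand \<open>w\<close> has larger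
  modulus than \<open>u - \<epsilon>\<^sub>i\<close>, so \<open>u - \<epsilon>\<^sub>i\<close> can be increased by a unit at some \<open>j\<close> at which \<open>w\<close> exceeds it
  (\<open>ex_unit_augmentation\<close>). This \<open>j\<close> differs from \<open>i\<close>, so \<open>w\<close> exceeds \<open>u\<close> there, which can only come
  from \<open>v\<^sub>T\<close>. Hence \<open>j\<close> lies in \<open>T\<close>, with \<open>u(j) < v(j)\<close>, and both exchanges are possible at \<open>j\<close>.\<close>

lemma modulus_add: "modulus (x + y) = modulus x + modulus y"
  by (simp add: modulus_def sum.distrib)

lemma modulus_diff: "modulus (x - y) = modulus x - modulus y"
  by (simp add: modulus_def sum_subtractf)

lemma modulus_axis: "modulus (axis i c) = c"
  by (simp add: modulus_def axis_def)

lemma modulus_mono: "x \<le> y \<Longrightarrow> modulus x \<le> modulus y"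
  by (simp add: modulus_def less_eq_vec_def sum_mono)

lemma eq_if_le_modulus_ge:
  assumes "x \<le> y" and "modulus y \<le> modulus x"
  shows "x = y"
proof (rule ccontr)
  assume "x \<noteq> y"
  then obtain k where "x $ k \<noteq> y $ k"
    by (auto simp: vec_eq_iff)
  with assms(1) have "x $ k < y $ k"
    by (simp add: less_eq_vec_def order_less_le)
  then have "modulus x < modulus y"
    unfolding modulus_def using assms(1)
    by (intro sum_strict_mono_ex1) (auto simp: less_eq_vec_def)
  with assms(2) show False
    by simp
qed

lemma ex_coord_less:
  fixes x y :: "int ^ 'n::finite"
  assumes "x < y"
  obtains j where "x $ j < y $ j"
  using assms by (auto simp: less_vec_def less_eq_vec_def not_le)

lemma discrete_polymatroid_nonneg:
  assumes "discrete_polymatroid P" and "x \<in> P"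
  shows "0 \<le> x $ k"
  using assms by (auto simp: discrete_polymatroid_def nonneg_vectors_def)

lemma discrete_polymatroid_downward_closed:
  assumes "discrete_polymatroid P" and "y \<in> P" and "x \<le> y" and "\<And>k. 0 \<le> x $ k"
  shows "x \<in> P"
  using assms by (auto simp: discrete_polymatroid_def nonneg_vectors_def)

lemma discrete_polymatroid_augment:
  assumes "discrete_polymatroid P" and "x \<in> P" and "y \<in> P" and "modulus x < modulus y"
  obtains w where "w \<in> P" "x < w" "w \<le> vec_join x y"
proof -
  have "\<exists>w\<in>P. x < w \<and> w \<le> vec_join x y"
    using assms by (simp add: discrete_polymatroid_def)
  with that show thesis
    by auto
qed

text \<open>Repeated augmentation: an element of maximal modulus between \<open>x\<close> and \<open>x \<or> y\<close> cannot be augmented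
  towards \<open>y\<close>, because augmenting it would not leave the box.\<close>

lemma ex_augmentation_below_join:
  fixes x y :: "int ^ 'n::finite"
  assumes P: "discrete_polymatroid P" and "x \<in> P" and "y \<in> P"
  obtains w where "w \<in> P" "x \<le> w" "w \<le> vec_join x y" "modulus y \<le> modulus w"
proof -
  define Q where "Q = {w \<in> P. x \<le> w \<and> w \<le> vec_join x y}"
  have "finite Q"
    using P by (simp add: Q_def discrete_polymatroid_def)
  moreover have "x \<in> Q"
    using \<open>x \<in> P\<close> by (simp add: Q_def vec_join_def less_eq_vec_def)
  ultimately have "Max (modulus ` Q) \<in> modulus ` Q"
    by (intro Max_in) auto
  then obtain w where w: "w \<in> Q" "modulus w = Max (modulus ` Q)"
    by auto
  have max: "modulus z \<le> modulus w" if "z \<in> Q" for z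
    using that w \<open>finite Q\<close> by simp
  have "modulus y \<le> modulus w"
  proof (rule ccontr)
    assume "\<not> modulus y \<le> modulus w"
    moreover have "w \<in> P"
      using w by (simp add: Q_def)
    ultimately obtain z where z: "z \<in> P" "w < z" "z \<le> vec_join w y"
      using discrete_polymatroid_augment[OF P _ \<open>y \<in> P\<close>] by (metis not_le)
    have "vec_join w y \<le> vec_join x y"
      using w by (auto simp: Q_def vec_join_def less_eq_vec_def)
    then have "z \<in> Q"
      using z w unfolding Q_def by (auto intro: order_trans less_imp_le)
    then have "w = z"
      using max z by (intro eq_if_le_modulus_ge) auto
    with z show False
      by simp
  qed
  with w that show thesis
    by (auto simp: Q_def)
qed

lemma ex_unit_augmentation:
  fixes x y :: "int ^ 'n::finite"
  assumes P: "discrete_polymatroid P" and "x \<in> P" and "y \<in> P" and "modulus x < modulus y"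
  obtains j where "x $ j < y $ j" "x + axis j 1 \<in> P"
proof -
  obtain w where w: "w \<in> P" "x < w" "w \<le> vec_join x y"
    using discrete_polymatroid_augment[OF assms] .
  obtain j where j: "x $ j < w $ j"
    using \<open>x < w\<close> by (rule ex_coord_less)
  have "w $ j \<le> max (x $ j) (y $ j)"
    using w by (simp add: less_eq_vec_def vec_join_def)
  with j have "x $ j < y $ j"
    by linarith
  moreover have "x + axis j 1 \<in> P"
  proof (rule discrete_polymatroid_downward_closed[OF P \<open>w \<in> P\<close>])
    show "x + axis j 1 \<le> w"
      using w j by (auto simp: less_eq_vec_def less_vec_def axis_def)
    show "0 \<le> (x + axis j 1) $ k" for k
      using discrete_polymatroid_nonneg[OF P \<open>x \<in> P\<close>, of k] by (simp add: axis_def)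
  qed
  ultimately show thesis
    by (rule that)
qed

lemma base_modulus_maximal:
  assumes "discrete_polymatroid P" and "polymatroid_base P u" and "w \<in> P"
  shows "modulus w \<le> modulus u"
  using assms discrete_polymatroid_augment
  by (metis not_le polymatroid_base_def)

lemma base_if_same_modulus:
  assumes P: "discrete_polymatroid P" and "polymatroid_base P u"
    and "w \<in> P" and "modulus w = modulus u"
  shows "polymatroid_base P w"
proof -
  have "\<not> w < z" if "z \<in> P" for z
    using base_modulus_maximal[OF P assms(2) that] assms(4) eq_if_le_modulus_ge[of w z]
    by (auto dest: less_imp_le)
  with \<open>w \<in> P\<close> show ?thesis
    by (auto simp: polymatroid_base_def)
qed

text \<open>Augmenting \<open>z\<close> towards \<open>v\<close> stays below \<open>v + \<epsilon>\<^sub>i\<close> and reaches modulus \<open>|v|\<close>. Since \<open>v + \<epsilon>\<^sub>i\<close>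
  itself is too large to be in \<open>P\<close>, the result misses it by exactly one unit, and the missing
  coordinate is \<open>j\<close>. In matroid terms: a set contained in \<open>v + i\<close> that includes the fundamental
  circuit of \<open>i\<close> is dependent.\<close>

lemma ex_exchange_below_base_plus_unit:
  fixes z v :: "int ^ 'n::finite"
  assumes P: "discrete_polymatroid P" and v: "polymatroid_base P v"
    and "z \<in> P" and z: "z \<le> v + axis i 1"
  obtains j where "z $ j < (v + axis i 1) $ j" "v + axis i 1 - axis j 1 \<in> P"
proof -
  have "v \<in> P"
    using v by (simp add: polymatroid_base_def)
  then obtain y where y: "y \<in> P" "z \<le> y" "y \<le> vec_join z v" "modulus v \<le> modulus y"
    using ex_augmentation_below_join[OF P \<open>z \<in> P\<close>] by metis
  have "vec_join z v \<le> v + axis i 1"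
    using z by (simp add: less_eq_vec_def vec_join_def axis_def)
  with y have le: "y \<le> v + axis i 1"
    by auto
  moreover have "y \<noteq> v + axis i 1"
    using base_modulus_maximal[OF P v \<open>y \<in> P\<close>] by (auto simp: modulus_add modulus_axis)
  ultimately obtain j where j: "y $ j < (v + axis i 1) $ j"
    by (metis ex_coord_less order_le_imp_less_or_eq)
  have "y = v + axis i 1 - axis j 1"
  proof (rule eq_if_le_modulus_ge)
    show "y \<le> v + axis i 1 - axis j 1"
      unfolding less_eq_vec_def
    proof
      fix k
      show "y $ k \<le> (v + axis i 1 - axis j 1) $ k"
        using le j by (cases "k = j") (auto simp: less_eq_vec_def axis_def)
    qed
    show "modulus (v + axis i 1 - axis j 1) \<le> modulus y"
      using y by (simp add: modulus_add modulus_diff modulus_axis)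
  qed
  with y have "v + axis i 1 - axis j 1 \<in> P"
    by simp
  moreover have "z $ j < (v + axis i 1) $ j"
    using y j by (auto simp: less_eq_vec_def intro: order_le_less_trans)
  ultimately show thesis
    using that by blast
qed

theorem theorem4p1:
  fixes P :: "(int ^ 'n::finite) set" and u v :: "int ^ 'n"
  assumes "discrete_polymatroid P"
    and "polymatroid_base P u"
    and "polymatroid_base P v"
  shows "\<forall>i. u $ i > v $ i \<longrightarrow>
           (\<exists>j. u $ j < v $ j \<and>
                polymatroid_base P (u - axis i 1 + axis j 1) \<and>
                polymatroid_base P (v - axis j 1 + axis i 1))"
proof (intro allI impI)
  fix i
  assume i: "u $ i > v $ i"
  note P = assms(1)
  have "u \<in> P" "v \<in> P"
    using assms by (auto simp: polymatroid_base_def)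
  note u_nonneg = discrete_polymatroid_nonneg[OF P \<open>u \<in> P\<close>]
  note v_nonneg = discrete_polymatroid_nonneg[OF P \<open>v \<in> P\<close>]
  define T where "T = {j. v + axis i 1 - axis j 1 \<in> P}"
  define vT where "vT = (\<chi> j. if j \<in> T then v $ j else 0)"
  have "i \<in> T"
    using \<open>v \<in> P\<close> by (simp add: T_def)
  have "vT \<in> P"
    by (rule discrete_polymatroid_downward_closed[OF P \<open>v \<in> P\<close>])
      (auto simp: vT_def less_eq_vec_def v_nonneg)
  have vT_plus_notin: "vT + axis i 1 \<notin> P"
  proof
    assume "vT + axis i 1 \<in> P"
    moreover have "vT + axis i 1 \<le> v + axis i 1"
      by (simp add: vT_def less_eq_vec_def v_nonneg)
    ultimately obtain j where "(vT + axis i 1) $ j < (v + axis i 1) $ j" "j \<in> T"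
      using ex_exchange_below_base_plus_unit[OF P assms(3)] unfolding T_def by blast
    then show False
      by (simp add: vT_def)
  qed
  obtain w where w: "w \<in> P" "vT \<le> w" "w \<le> vec_join vT u" "modulus u \<le> modulus w"
    using ex_augmentation_below_join[OF P \<open>vT \<in> P\<close> \<open>u \<in> P\<close>] .
  have w_i: "w $ i \<le> v $ i"
  proof (rule ccontr)
    assume "\<not> w $ i \<le> v $ i"
    with \<open>vT \<le> w\<close> \<open>i \<in> T\<close> have "vT + axis i 1 \<le> w"
      by (auto simp: less_eq_vec_def axis_def vT_def)
    then have "vT + axis i 1 \<in> P"
      by (rule discrete_polymatroid_downward_closed[OF P \<open>w \<in> P\<close>])
        (simp add: vT_def axis_def v_nonneg)
    with vT_plus_notin show False ..
  qed
  have "u - axis i 1 \<in> P"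
  proof (rule discrete_polymatroid_downward_closed[OF P \<open>u \<in> P\<close>])
    show "u - axis i 1 \<le> u"
      by (simp add: less_eq_vec_def axis_def)
    show "0 \<le> (u - axis i 1) $ k" for k
      using u_nonneg[of k] v_nonneg[of k] i by (auto simp: axis_def)
  qed
  moreover have "modulus (u - axis i 1) < modulus w"
    using w by (simp add: modulus_diff modulus_axis)
  ultimately obtain j where j: "(u - axis i 1) $ j < w $ j" "u - axis i 1 + axis j 1 \<in> P"
    using ex_unit_augmentation[OF P _ \<open>w \<in> P\<close>] by metis
  have "j \<noteq> i"
    using j w_i i by (auto simp: axis_def)
  then have "u $ j < w $ j"
    using j by (simp add: axis_def)
  moreover have "w $ j \<le> max (vT $ j) (u $ j)"
    using w by (simp add: less_eq_vec_def vec_join_def)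
  ultimately have "u $ j < vT $ j"
    by linarith
  then have "j \<in> T" "u $ j < v $ j"
    using u_nonneg[of j] by (auto simp: vT_def split: if_splits)
  moreover have "v - axis j 1 + axis i 1 \<in> P"
    using \<open>j \<in> T\<close> by (simp add: T_def algebra_simps)
  ultimately show "\<exists>j. u $ j < v $ j \<and>
                polymatroid_base P (u - axis i 1 + axis j 1) \<and>
                polymatroid_base P (v - axis j 1 + axis i 1)"
    using j base_if_same_modulus[OF P assms(2)] base_if_same_modulus[OF P assms(3)]
    by (intro exI[of _ j]) (simp add: modulus_add modulus_diff modulus_axis)
qed

end
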